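(* For every (finite) simple graph $G$, $\chi_c^s(G)\le 2\chi_c(G)$.
   Context: A signed graph $(G,\sigma)$ is a graph $G$ with a signature $\sigma:E(G)\to\{+,-\}$. For real $r\ge 1$, $C^r$ is the circle of circumference $r$ (points are $[0,r)$), $d_{(\mathrm{mod}\, r)}(x,y)$ is the length of the shorter arc of $C^r$ between $x$ and $y$, and the antipodal $\bar x$ of $x$ is the point at distance $r/2$ from $x$. A circular $r$-coloring of $(G,\sigma)$ is a map $f:V(G)\to C^r$ such that $d_{(\mathrm{mod}\, r)}(f(u),f(v))\ge 1$ for each positive edge $uv$ and $d_{(\mathrm{mod}\, r)}(f(u),\overline{f(v)})\ge 1$ for each negative edge $uv$. $\chi_c(G,\sigma)=\inf\{r\ge 1: (G,\sigma)\text{ admits a circular } r\text{-coloring}\}$. For an (unsigned) graph $G$, the circular chromatic number is $\chi_c(G)=\inf\{r\ge 1:\exists f:V(G)\to C^r \text{ with } d_{(\mathrm{mod}\, r)}(f(u),f(v))\ge 1 \text{ for every edge } uv\}$. For a simple graph $G$, $\chi_c^s(G)=\max\{\chi_c(G,\sigma):\sigma\text{ is a signature of }G\}$. *)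

theory Defs
  imports Complex_Main "HOL-Library.FuncSet"
begin

definition fin_simple_graph :: "'a set \<Rightarrow> 'a set set \<Rightarrow> bool" where
  "fin_simple_graph V E \<longleftrightarrow> finite V \<and> (\<forall>e\<in>E. e \<subseteq> V \<and> card e = 2)"

definition circle :: "real \<Rightarrow> real set" where
  "circle r = {0..<r}"

text \<open>
  Two points of \<^term>\<open>circle r\<close> cut the circle into arcs of lengths \<^term>\<open>\<bar>x - y\<bar>\<close> and
  \<^term>\<open>r - \<bar>x - y\<bar>\<close>. The formula is meaningful only for points of \<^term>\<open>circle r\<close>.
\<close>
definition circ_dist :: "real \<Rightarrow> real \<Rightarrow> real \<Rightarrow> real" where
  "circ_dist r x y = min \<bar>x - y\<bar> (r - \<bar>x - y\<bar>)"

definition antipode :: "real \<Rightarrow> real \<Rightarrow> real" where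
  "antipode r x = (THE y. y \<in> circle r \<and> circ_dist r x y = r / 2)"

lemma antipode_eq:
  assumes "x \<in> circle r"
  shows "antipode r x = (if x < r / 2 then x + r / 2 else x - r / 2)"
  unfolding antipode_def using assms
  by (intro the_equality) (auto simp: circle_def circ_dist_def min_def abs_if split: if_splits)

definition circular_coloring :: "'a set \<Rightarrow> 'a set set \<Rightarrow> real \<Rightarrow> ('a \<Rightarrow> real) \<Rightarrow> bool" where
  "circular_coloring V E r f \<longleftrightarrow>
     f \<in> V \<rightarrow> circle r \<and> (\<forall>u v. {u, v} \<in> E \<longrightarrow> circ_dist r (f u) (f v) \<ge> 1)"

definition circular_chromatic_number :: "'a set \<Rightarrow> 'a set set \<Rightarrow> real" where
  "circular_chromatic_number V E = Inf {r. r \<ge> 1 \<and> (\<exists>f. circular_coloring V E r f)}"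

datatype edge_sign = Positive | Negative

definition signed_circular_coloring ::
    "'a set \<Rightarrow> 'a set set \<Rightarrow> ('a set \<Rightarrow> edge_sign) \<Rightarrow> real \<Rightarrow> ('a \<Rightarrow> real) \<Rightarrow> bool" where
  "signed_circular_coloring V E \<sigma> r f \<longleftrightarrow>
     f \<in> V \<rightarrow> circle r \<and>
     (\<forall>u v. {u, v} \<in> E \<longrightarrow> \<sigma> {u, v} = Positive \<longrightarrow> circ_dist r (f u) (f v) \<ge> 1) \<and>
     (\<forall>u v. {u, v} \<in> E \<longrightarrow> \<sigma> {u, v} = Negative \<longrightarrow> circ_dist r (f u) (antipode r (f v)) \<ge> 1)"

definition signed_circular_chromatic_number ::
    "'a set \<Rightarrow> 'a set set \<Rightarrow> ('a set \<Rightarrow> edge_sign) \<Rightarrow> real" where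
  "signed_circular_chromatic_number V E \<sigma> =
     Inf {r. r \<ge> 1 \<and> (\<exists>f. signed_circular_coloring V E \<sigma> r f)}"

text \<open>Extensional functions, so that a finite graph has only finitely many signatures.\<close>
definition signatures :: "'a set set \<Rightarrow> ('a set \<Rightarrow> edge_sign) set" where
  "signatures E = E \<rightarrow>\<^sub>E UNIV"

definition max_signed_circular_chromatic_number :: "'a set \<Rightarrow> 'a set set \<Rightarrow> real" where
  "max_signed_circular_chromatic_number V E =
     Max (signed_circular_chromatic_number V E ` signatures E)"

text \<open>
  The infima and the maximum above are over nonempty sets, respectively over a finite
  nonempty set, so the default values of \<^const>\<open>Inf\<close> and \<^const>\<open>Max\<close> play no role.
\<close>

lemma finite_edges:
  assumes "fin_simple_graph V E"
  shows "finite E"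
  using assms by (auto simp: fin_simple_graph_def intro!: finite_subset[of E "Pow V"])

lemma finite_signatures:
  assumes "fin_simple_graph V E"
  shows "finite (signatures E)"
proof -
  have "(UNIV :: edge_sign set) = {Positive, Negative}"
    using edge_sign.exhaust by auto
  then have "finite (UNIV :: edge_sign set)"
    by (metis finite.emptyI finite.insertI)
  then show ?thesis
    unfolding signatures_def using finite_edges[OF assms] by (intro finite_PiE) auto
qed

lemma signatures_nonempty: "signatures E \<noteq> {}"
  by (simp add: signatures_def PiE_eq_empty_iff)

lemma separated_vertex_numbering:
  assumes "fin_simple_graph V E"
  obtains n :: nat and g :: "'a \<Rightarrow> nat" where
    "n \<ge> 1" "\<And>v. v \<in> V \<Longrightarrow> g v < n"
    "\<And>u v. {u, v} \<in> E \<Longrightarrow> u \<in> V \<and> v \<in> V \<and> g u \<noteq> g v"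
proof -
  obtain g :: "'a \<Rightarrow> nat" and m where g: "g ` V = {i. i < m}" "inj_on g V"
    using finite_imp_inj_to_nat_seg assms unfolding fin_simple_graph_def by metis
  have "g v < Suc m" if "v \<in> V" for v
    using g(1) that by (metis imageI less_Suc_eq mem_Collect_eq)
  moreover have "u \<in> V \<and> v \<in> V \<and> g u \<noteq> g v" if "{u, v} \<in> E" for u v
  proof -
    have "{u, v} \<subseteq> V" "card {u, v} = 2"
      using assms that unfolding fin_simple_graph_def by blast+
    then show ?thesis
      using g(2) by (cases "u = v") (auto dest: inj_onD)
  qed
  ultimately show thesis
    using that[of "Suc m" g] by simp
qed

lemma circular_coloring_exists:
  assumes "fin_simple_graph V E"
  shows "\<exists>r\<ge>1. \<exists>f. circular_coloring V E r f"
proof -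
  obtain n and g :: "'a \<Rightarrow> nat" where n: "n \<ge> 1" and lt: "\<And>v. v \<in> V \<Longrightarrow> g v < n"
    and ne: "\<And>u v. {u, v} \<in> E \<Longrightarrow> u \<in> V \<and> v \<in> V \<and> g u \<noteq> g v"
    using separated_vertex_numbering[OF assms] by metis
  have "circ_dist (real n) (real (g u)) (real (g v)) \<ge> 1" if "{u, v} \<in> E" for u v
    using ne[OF that] lt[of u] lt[of v] by (auto simp: circ_dist_def)
  then have "circular_coloring V E (real n) (\<lambda>v. real (g v))"
    using lt by (auto simp: circular_coloring_def circle_def)
  then show ?thesis
    using n by (metis of_nat_1 of_nat_le_iff)
qed

lemma signed_circular_coloring_exists:
  assumes "fin_simple_graph V E"
  shows "\<exists>r\<ge>1. \<exists>f. signed_circular_coloring V E \<sigma> r f"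
proof -
  obtain n and g :: "'a \<Rightarrow> nat" where n: "n \<ge> 1" and lt: "\<And>v. v \<in> V \<Longrightarrow> g v < n"
    and ne: "\<And>u v. {u, v} \<in> E \<Longrightarrow> u \<in> V \<and> v \<in> V \<and> g u \<noteq> g v"
    using separated_vertex_numbering[OF assms] by metis
  let ?r = "2 * real n"
  have pos: "circ_dist ?r (real (g u)) (real (g v)) \<ge> 1" if "{u, v} \<in> E" for u v
    using ne[OF that] lt[of u] lt[of v] by (auto simp: circ_dist_def)
  have neg: "circ_dist ?r (real (g u)) (antipode ?r (real (g v))) \<ge> 1" if "{u, v} \<in> E" for u v
  proof -
    have l: "g u < n" "g v < n" using ne[OF that] lt by auto
    then have "antipode ?r (real (g v)) = real (g v) + real n"
      by (subst antipode_eq) (auto simp: circle_def)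
    then show ?thesis using l by (auto simp: circ_dist_def)
  qed
  have "signed_circular_coloring V E \<sigma> ?r (\<lambda>v. real (g v))"
    using lt pos neg by (fastforce simp: signed_circular_coloring_def circle_def)
  moreover have "?r \<ge> 1" using n by linarith
  ultimately show ?thesis by blast
qed

end

(* A circular r-coloring takes values in [0,r), which is a half of the circle of
   circumference 2r. Read there, the same map is a coloring for every signature: the antipode
   of f(v) is f(v) + r, and its two arcs to f(u) have lengths r + f(v) - f(u) and
   r - f(v) + f(u), both at least r - |f(u) - f(v)| and hence at least 1. *)
theory Submission
  imports Defs
begin

lemma signed_circular_coloring_double:
  assumes graph: "fin_simple_graph V E" and col: "circular_coloring V E r f"
  shows "signed_circular_coloring V E \<sigma> (2 * r) f"
proof -
  have range: "0 \<le> f v \<and> f v < r" if "v \<in> V" for v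
    using col that by (auto simp: circular_coloring_def circle_def)
  have both: "circ_dist (2 * r) (f u) (f v) \<ge> 1 \<and>
      circ_dist (2 * r) (f u) (antipode (2 * r) (f v)) \<ge> 1"
    if "{u, v} \<in> E" for u v
  proof -
    have "u \<in> V" "v \<in> V"
      using graph that unfolding fin_simple_graph_def by blast+
    then have b: "0 \<le> f u" "f u < r" "0 \<le> f v" "f v < r"
      using range by auto
    have d: "circ_dist r (f u) (f v) \<ge> 1"
      using col that by (auto simp: circular_coloring_def)
    have "antipode (2 * r) (f v) = f v + r"
      using b by (subst antipode_eq) (auto simp: circle_def)
    \<comment> \<open>\<open>d\<close> bounds both arcs in \<open>circle r\<close>. Doubling only
      lengthens the outer arc, which settles the positive case; for the antipode, \<open>b\<close>
      gives \<open>f u - f v < r\<close>, which resolves the absolute value.\<close>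
    then show ?thesis
      using b d by (auto simp: circ_dist_def)
  qed
  have "f \<in> V \<rightarrow> circle (2 * r)"
    using range by (fastforce simp: circle_def)
  then show ?thesis
    using both by (auto simp: signed_circular_coloring_def)
qed

lemma signed_circular_chromatic_number_le_double:
  assumes "fin_simple_graph V E"
  shows "signed_circular_chromatic_number V E \<sigma> \<le> 2 * circular_chromatic_number V E"
proof -
  \<comment> \<open>Halving the left side makes it a lower bound of the very set whose infimum is
    \<open>circular_chromatic_number V E\<close>, so no infimum has to be scaled.\<close>
  have "signed_circular_chromatic_number V E \<sigma> / 2 \<le> r"
    if "r \<ge> 1" "circular_coloring V E r f" for r f
  proof -
    have "signed_circular_chromatic_number V E \<sigma> \<le> 2 * r"
      unfolding signed_circular_chromatic_number_def
    proof (rule cInf_lower)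
      show "2 * r \<in> {r. r \<ge> 1 \<and> (\<exists>f. signed_circular_coloring V E \<sigma> r f)}"
        using signed_circular_coloring_double[OF assms that(2)] that(1) by auto
      show "bdd_below {r. r \<ge> 1 \<and> (\<exists>f. signed_circular_coloring V E \<sigma> r f)}"
        by (rule bdd_belowI[of _ 1]) auto
    qed
    then show ?thesis by simp
  qed
  then have "signed_circular_chromatic_number V E \<sigma> / 2 \<le> circular_chromatic_number V E"
    unfolding circular_chromatic_number_def
    \<comment> \<open>\<open>cInf_greatest\<close> needs a nonempty set, hence some coloring must
      exist.\<close>
    using circular_coloring_exists[OF assms] by (intro cInf_greatest) auto
  then show ?thesis by simp
qed

theorem corollary4p3:
  fixes V :: "'a set" and E :: "'a set set"
  assumes "fin_simple_graph V E"
  shows "max_signed_circular_chromatic_number V E \<le> 2 * circular_chromatic_number V E"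
  unfolding max_signed_circular_chromatic_number_def
  using finite_signatures[OF assms] signatures_nonempty
    signed_circular_chromatic_number_le_double[OF assms]
  \<comment> \<open>The bound is uniform in the signature, so it passes to the maximum.\<close>
  by (subst Max_le_iff) auto

end
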